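(* In the setting described in the context, let $u^*\in K$ be the minimizer of $E$ over $K$, let $\{u_h^k\}_{k=1}^{\ell}$ be the primal proximal Galerkin iterates, let $o^*=Bu^*$ and $o_h^0=\nabla\mathcal R^*(\psi_h^0)$, and let $\Pi_h$ be a Fortin operator. Then for every $\ell\ge1$, $$\frac{\nu}{2}\|u^*-u_h^\ell\|_V^2\le\frac{(\mathcal D(o^*,o_h^0),1)_{\Omega_d}}{\sum_{k=1}^\ell\alpha_k}+\frac{M^2}{2\nu}\|\Pi_hu^*-u^*\|_V^2+|\langle E'(u^* ),\Pi_hu^*-u^*\rangle|+\inf_{v\in K}|\langle E'(u^* ),v-u_h^\ell\rangle|.$$
   Context: Setting. $\Omega\subset\mathbb R^n$ ($n\in\{1,2,3\}$) is an open bounded polygonal/polyhedral domain. $\Omega_d\subset\overline\Omega$ is a Hausdorff-measurable set of Hausdorff dimension $d\le n$ with Hausdorff measure $\mathcal H_d$ (coinciding with the induced surface measure), and $(\cdot,\cdot)_{\Omega_d}$ is the $L^2(\Omega_d)$ inner product. $V$ is a real Hilbert space with dual $V'$ and duality pairing $\langle\cdot,\cdot\rangle$; $B:V\to Q$ is a surjective bounded linear map whose image $Q$ (a Hilbert space) is continuously and densely embedded in $L^2(\Omega_d;\mathbb R^m)$. For a.e. $x\in\Omega_d$, $C(x)\subset\mathbb R^m$ is a closed convex set with nonempty interior. Set $\mathcal O=\{o\in L^2(\Omega_d;\mathbb R^m): o(x)\in C(x)\text{ for a.e. }x\in\Omega_d\}$ and $K=\{v\in V:Bv\in\mathcal O\}$,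 assumed closed, convex, nonempty. The bilinear form $a$ on $V$ is symmetric with $a(u,u)\ge\nu\|u\|_V^2$ and $a(u,v)\le M\|u\|_V\|v\|_V$ for constants $\nu,M>0$; $F\in V'$; $E(v)=\tfrac12a(v,v)-F(v)$, so $\langle E'(u),v\rangle=a(u,v)-F(v)$. The problem $\min_{v\in K}E(v)$ has a unique solution $u^*$, characterized by $a(u^*,v-u^* )\ge F(v-u^* )$ for all $v\in K$. Let $W=L^\infty(\Omega_d;\mathbb R^m)$, regarded as a subset of $Q'$ via $\langle w,q\rangle=(w,q)_{\Omega_d}$, and $b(v,w)=(Bv,w)_{\Omega_d}$. Legendre function. A function $L:\mathbb R^m\to\mathbb R\cup\{+\infty\}$ is Legendre if it is proper with $\operatorname{int}(\operatorname{dom}L)\ne\emptyset$, strictly convex and differentiable on $\operatorname{int}(\operatorname{dom}L)$, with singular gradient on the boundary of $\operatorname{dom}L$. Let $R:\Omega_d\times\mathbb R^m\to\mathbb R\cup\{+\infty\}$ be Carathéodory with $R(x,\cdot)$ Legendre, $\operatorname{dom}R(x,\cdot)=C(x)$, and $R(x,y)/|y|\to\infty$ as $|y|\to\infty$, for a.e. $x$. Put $\mathcal R(w)(x)=R(x,w(x))$, $\nabla\mathcal R(w)(x)=\partial_uR(x,w(x))$, and assume $\mathcal R:\mathcal O\to L^1(\Omega_d)$ is continuous ($\mathcal O$ with the $L^2$ topology). Let $R^*(x,z)=\sup_{y\in\mathbb R^m}\{z\cdot y-R(x,y)\}$, $\mathcal R^*(\psi)(x)=R^*(x,\psi(x))$,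 $\nabla\mathcal R^*(\psi)(x)=\partial_zR^*(x,\psi(x))$. Then $\nabla\mathcal R^*:W\to\mathcal O$ is continuous and $\nabla\mathcal R^*=(\nabla\mathcal R)^{-1}$. The Bregman divergence is $\mathcal D(u,v)=\mathcal R(u)-\mathcal R(v)-\nabla\mathcal R(v)\cdot(u-v)$ for $u\in\operatorname{dom}\mathcal R$, $v\in\operatorname{dom}\nabla\mathcal R$. Discrete spaces and iterates. $V_h\subset V$ and $W_h\subset W$ are finite-dimensional subspaces satisfying $\inf_{w\in W_h}\sup_{v\in V_h}\frac{b(v,w)}{\|v\|_V\|w\|_{Q'}}=\beta_h>\beta_0>0$ with $\beta_0$ mesh-independent. A Fortin operator is a continuous linear map $\Pi_h:V\to V_h$ with $\|\Pi_hv\|_V\lesssim\|v\|_V$ (constant independent of $h$) and $b(v-\Pi_hv,w_h)=0$ for all $v\in V$, $w_h\in W_h$. Given $\psi_h^0\in W_h$ and positive parameters $\{\alpha_k\}$ with $\sum_k\alpha_k=\infty$, the proximal Galerkin iterates $(u_h^k,\psi_h^k)\in V_h\times W_h$, $k\ge1$, are the (unique) solutions of $$\alpha_k a(u_h^k,v_h)+b(v_h,\psi_h^k-\psi_h^{k-1})=\alpha_kF(v_h)\ \ \forall v_h\in V_h,\qquad b(u_h^k,w_h)-(\nabla\mathcal R^*(\psi_h^k),w_h)_{\Omega_d}=0\ \ \forall w_h\in W_h.$$ *)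

theory Defs
  imports "HOL-Analysis.Analysis"
begin

section \<open>Hausdorff measure and dimension\<close>

text \<open>The constant \<^term>\<open>unit_ball_vol s / 2 powr s\<close> is the one for which the measure of integer
  dimension agrees with surface measure (and with Lebesgue measure in full dimension). The empty set
  has weight 0 and, for \<open>s = 0\<close>, every nonempty set has weight 1; the case distinction is needed
  because \<^prop>\<open>(0::real) powr 0 = 0\<close>.\<close>

definition hausdorff_weight :: "real \<Rightarrow> 'a::metric_space set \<Rightarrow> ennreal" where
  "hausdorff_weight s S =
     (if S = {} then 0
      else if s = 0 then 1
      else ennreal (unit_ball_vol s * (diameter S / 2) powr s))"

definition hausdorff_pre :: "real \<Rightarrow> real \<Rightarrow> 'a::metric_space set \<Rightarrow> ennreal" where
  "hausdorff_pre s \<delta> A =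
     (INF S \<in> {S :: nat \<Rightarrow> 'a set. A \<subseteq> (\<Union>i. S i) \<and> (\<forall>i. bounded (S i) \<and> diameter (S i) \<le> \<delta>)}.
        \<Sum>i. hausdorff_weight s (S i))"

definition hausdorff_outer :: "real \<Rightarrow> 'a::metric_space set \<Rightarrow> ennreal" where
  "hausdorff_outer s A = (SUP \<delta> \<in> {0<..}. hausdorff_pre s \<delta> A)"

definition hausdorff_measure :: "real \<Rightarrow> 'a::metric_space measure" where
  "hausdorff_measure s =
     measure_of UNIV (lambda_system UNIV UNIV (hausdorff_outer s)) (hausdorff_outer s)"

definition hausdorff_dim :: "'a::metric_space set \<Rightarrow> real" where
  "hausdorff_dim A = Inf {s. 0 \<le> s \<and> hausdorff_outer s A = 0}"

lemma hausdorff_pre_empty: "0 < \<delta> \<Longrightarrow> hausdorff_pre s \<delta> {} = 0"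
proof -
  assume "0 < \<delta>"
  then have "hausdorff_pre s \<delta> ({} :: 'a set) \<le> (\<Sum>i::nat. hausdorff_weight s ({} :: 'a set))"
    unfolding hausdorff_pre_def by (intro INF_lower) auto
  then show ?thesis by (simp add: hausdorff_weight_def)
qed

lemma hausdorff_pre_mono: "A \<subseteq> B \<Longrightarrow> hausdorff_pre s \<delta> A \<le> hausdorff_pre s \<delta> B"
  unfolding hausdorff_pre_def by (rule INF_superset_mono) auto

lemma hausdorff_pre_subadditive:
  fixes A :: "nat \<Rightarrow> 'a::metric_space set"
  shows "hausdorff_pre s \<delta> (\<Union>i. A i) \<le> (\<Sum>i. hausdorff_pre s \<delta> (A i))"
proof (rule ennreal_le_epsilon)
  fix e :: real
  assume e: "0 < e" and fin: "(\<Sum>n. hausdorff_pre s \<delta> (A n)) < top"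
  have lt: "hausdorff_pre s \<delta> (A n) < hausdorff_pre s \<delta> (A n) + ennreal (e * (1/2) ^ Suc n)" for n
    using e fin by (auto simp add: less_top dest!: ennreal_suminf_lessD)
  have "\<exists>S. A n \<subseteq> (\<Union>i. S i) \<and> (\<forall>i::nat. bounded (S i) \<and> diameter (S i) \<le> \<delta>) \<and>
           (\<Sum>i. hausdorff_weight s (S i)) \<le> hausdorff_pre s \<delta> (A n) + ennreal (e * (1/2) ^ Suc n)" for n
    using lt[of n] unfolding hausdorff_pre_def INF_less_iff by (auto intro: less_imp_le)
  then obtain S where S: "\<And>n. A n \<subseteq> (\<Union>i. S n i)"
      "\<And>n i. bounded (S n i) \<and> diameter (S n i) \<le> \<delta>"
      "\<And>n. (\<Sum>i::nat. hausdorff_weight s (S n i)) \<le> hausdorff_pre s \<delta> (A n) + ennreal (e * (1/2) ^ Suc n)"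
    by metis
  define T where "T = case_prod S \<circ> prod_decode"
  have cov: "(\<Union>i. A i) \<subseteq> (\<Union>i. T i)"
    using S(1) by (auto simp add: T_def subset_eq) (metis prod.case prod_encode_inverse)
  have "hausdorff_pre s \<delta> (\<Union>i. A i) \<le> (\<Sum>i. hausdorff_weight s (T i))"
    unfolding hausdorff_pre_def using cov S(2)
    by (intro INF_lower) (auto simp: T_def split_def)
  also have "\<dots> = (\<Sum>n. \<Sum>i. hausdorff_weight s (S n i))"
    unfolding T_def comp_def
    using suminf_ennreal_2dimen[of "\<lambda>n. \<Sum>i. hausdorff_weight s (S n i)"
        "\<lambda>p. hausdorff_weight s (S (fst p) (snd p))"]
    by (simp add: split_def comp_def)
  also have "\<dots> \<le> (\<Sum>n. hausdorff_pre s \<delta> (A n) + ennreal (e * (1/2) ^ Suc n))"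
    by (intro suminf_le S(3)) auto
  also have "\<dots> = (\<Sum>n. hausdorff_pre s \<delta> (A n)) + (\<Sum>n. ennreal (e * (1/2) ^ Suc n))"
    by (subst suminf_add[symmetric]) auto
  also have "(\<Sum>n. ennreal (e * (1/2) ^ Suc n)) = ennreal e"
    using e sums_mult[OF power_half_series, of e] by (intro suminf_ennreal_eq) auto
  finally show "hausdorff_pre s \<delta> (\<Union>i. A i) \<le> (\<Sum>n. hausdorff_pre s \<delta> (A n)) + ennreal e" .
qed

lemma outer_measure_space_hausdorff:
  "outer_measure_space UNIV (hausdorff_outer s :: 'a::metric_space set \<Rightarrow> ennreal)"
proof -
  have pos: "hausdorff_outer s ({} :: 'a set) = 0"
    unfolding hausdorff_outer_def by (auto simp: hausdorff_pre_empty intro!: SUP_eq_const)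
  have mono: "A \<subseteq> B \<Longrightarrow> hausdorff_outer s A \<le> hausdorff_outer s B" for A B :: "'a set"
    unfolding hausdorff_outer_def by (intro SUP_mono) (auto intro: hausdorff_pre_mono)
  have sub: "hausdorff_outer s (\<Union>i. A i) \<le> (\<Sum>i. hausdorff_outer s (A i))" for A :: "nat \<Rightarrow> 'a set"
    unfolding hausdorff_outer_def[of s "\<Union>i. A i"]
  proof (rule SUP_least)
    fix \<delta> :: real assume d: "\<delta> \<in> {0<..}"
    have "hausdorff_pre s \<delta> (\<Union>i. A i) \<le> (\<Sum>i. hausdorff_pre s \<delta> (A i))"
      by (rule hausdorff_pre_subadditive)
    also have "\<dots> \<le> (\<Sum>i. hausdorff_outer s (A i))"
      using d by (intro suminf_le) (auto simp: hausdorff_outer_def intro: SUP_upper)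
    finally show "hausdorff_pre s \<delta> (\<Union>i. A i) \<le> (\<Sum>i. hausdorff_outer s (A i))" .
  qed
  show ?thesis
    using pos mono sub
    by (auto simp: outer_measure_space_def positive_def increasing_def countably_subadditive_def)
qed

lemma measure_space_hausdorff:
  "measure_space UNIV (lambda_system UNIV UNIV (hausdorff_outer s))
     (hausdorff_outer s :: 'a::metric_space set \<Rightarrow> ennreal)"
  using sigma_algebra.caratheodory_lemma[OF sigma_algebra_Pow[of "UNIV :: 'a set"], of "hausdorff_outer s"]
    outer_measure_space_hausdorff[of s, where 'a = 'a] by simp

lemma sets_hausdorff_measure:
  "sets (hausdorff_measure s :: 'a::metric_space measure) = lambda_system UNIV UNIV (hausdorff_outer s)"
  using measure_space_hausdorff[of s, where 'a = 'a] unfolding hausdorff_measure_def measure_space_def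
  by (simp add: sigma_algebra.sigma_sets_eq)

lemma emeasure_hausdorff_measure:
  assumes "A \<in> sets (hausdorff_measure s)"
  shows "emeasure (hausdorff_measure s) A = hausdorff_outer s A"
proof (rule emeasure_measure_of[OF hausdorff_measure_def _ _ _ assms])
  show "positive (sets (hausdorff_measure s)) (hausdorff_outer s)"
    and "countably_additive (sets (hausdorff_measure s)) (hausdorff_outer s)"
    using measure_space_hausdorff[of s] by (auto simp: sets_hausdorff_measure measure_space_def)
qed simp


section \<open>Polyhedral domains\<close>

definition polyhedral_domain :: "'a::euclidean_space set \<Rightarrow> bool" where
  "polyhedral_domain S \<longleftrightarrow>
     open S \<and> connected S \<and> S \<noteq> {} \<and> bounded S \<and>
     (\<exists>\<P>. finite \<P> \<and> (\<forall>P\<in>\<P>. polytope P) \<and> frontier S = \<Union>\<P>)"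


section \<open>Lebesgue spaces of vector fields\<close>

text \<open>Elements of a Lebesgue space are represented by functions; two functions denote the same element
  iff they agree almost everywhere. All sets of measurable functions below are closed under this relation.\<close>

definition L2_space :: "'x measure \<Rightarrow> ('x \<Rightarrow> 'a::euclidean_space) set" where
  "L2_space \<mu> = {f \<in> borel_measurable \<mu>. integrable \<mu> (\<lambda>x. (norm (f x))\<^sup>2)}"

definition L2_inner :: "'x measure \<Rightarrow> ('x \<Rightarrow> 'a::euclidean_space) \<Rightarrow> ('x \<Rightarrow> 'a) \<Rightarrow> real" where
  "L2_inner \<mu> f g = (\<integral>x. f x \<bullet> g x \<partial>\<mu>)"

definition L2_norm :: "'x measure \<Rightarrow> ('x \<Rightarrow> 'a::euclidean_space) \<Rightarrow> real" where
  "L2_norm \<mu> f = sqrt (L2_inner \<mu> f f)"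

definition Linf_space :: "'x measure \<Rightarrow> ('x \<Rightarrow> 'a::euclidean_space) set" where
  "Linf_space \<mu> = {f \<in> borel_measurable \<mu>. \<exists>c. AE x in \<mu>. norm (f x) \<le> c}"

definition findim_subspace_Linf :: "'x measure \<Rightarrow> ('x \<Rightarrow> 'a::euclidean_space) set \<Rightarrow> bool" where
  "findim_subspace_Linf \<mu> X \<longleftrightarrow>
     (\<exists>G. finite G \<and> G \<subseteq> Linf_space \<mu> \<and>
        X = {w \<in> Linf_space \<mu>. \<exists>c. AE x in \<mu>. w x = (\<Sum>g\<in>G. c g *\<^sub>R g x)})"

definition findim_subspace :: "'v::real_vector set \<Rightarrow> bool" where
  "findim_subspace X \<longleftrightarrow> (\<exists>G. finite G \<and> X = span G)"

definition dense_L2_embedding ::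
    "'x measure \<Rightarrow> ('q::real_normed_vector \<Rightarrow> 'x \<Rightarrow> 'a::euclidean_space) \<Rightarrow> bool" where
  "dense_L2_embedding \<mu> \<iota> \<longleftrightarrow>
     (\<forall>q. \<iota> q \<in> L2_space \<mu>) \<and>
     (\<forall>p q. AE x in \<mu>. \<iota> (p + q) x = \<iota> p x + \<iota> q x) \<and>
     (\<forall>c q. AE x in \<mu>. \<iota> (c *\<^sub>R q) x = c *\<^sub>R \<iota> q x) \<and>
     (\<forall>q. (AE x in \<mu>. \<iota> q x = 0) \<longrightarrow> q = 0) \<and>
     (\<exists>c. \<forall>q. L2_norm \<mu> (\<iota> q) \<le> c * norm q) \<and>
     (\<forall>f\<in>L2_space \<mu>. \<forall>\<epsilon>>0. \<exists>q. L2_norm \<mu> (\<lambda>x. f x - \<iota> q x) < \<epsilon>)"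

text \<open>Norm of \<open>w\<close> as the functional \<open>q \<mapsto> (w, q)\<close> on the embedded space.\<close>

definition dual_norm ::
    "'x measure \<Rightarrow> ('q::real_normed_vector \<Rightarrow> 'x \<Rightarrow> 'a::euclidean_space) \<Rightarrow> ('x \<Rightarrow> 'a) \<Rightarrow> real" where
  "dual_norm \<mu> \<iota> w = onorm (\<lambda>q. L2_inner \<mu> w (\<iota> q))"


section \<open>Legendre functions, conjugates and Bregman divergences\<close>

definition gradient :: "('a::real_inner \<Rightarrow> real) \<Rightarrow> 'a \<Rightarrow> 'a" where
  "gradient f x = (THE D. GDERIV f x :> D)"

definition strictly_convex_on :: "'a::real_vector set \<Rightarrow> ('a \<Rightarrow> real) \<Rightarrow> bool" where
  "strictly_convex_on S f \<longleftrightarrow> convex S \<and>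
     (\<forall>x\<in>S. \<forall>y\<in>S. \<forall>t. x \<noteq> y \<longrightarrow> 0 < t \<longrightarrow> t < 1 \<longrightarrow>
        f ((1 - t) *\<^sub>R x + t *\<^sub>R y) < (1 - t) * f x + t * f y)"

definition eff_dom :: "('a \<Rightarrow> ereal) \<Rightarrow> 'a set" where
  "eff_dom L = {y. L y < \<infinity>}"

definition proper_fun :: "('a \<Rightarrow> ereal) \<Rightarrow> bool" where
  "proper_fun L \<longleftrightarrow> (\<forall>y. L y \<noteq> -\<infinity>) \<and> eff_dom L \<noteq> {}"

definition legendre :: "('a::euclidean_space \<Rightarrow> ereal) \<Rightarrow> bool" where
  "legendre L \<longleftrightarrow>
     proper_fun L \<and>
     interior (eff_dom L) \<noteq> {} \<and>
     strictly_convex_on (interior (eff_dom L)) (\<lambda>y. real_of_ereal (L y)) \<and>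
     (\<forall>y\<in>interior (eff_dom L). (\<lambda>y. real_of_ereal (L y)) differentiable at y) \<and>
     (\<forall>y\<in>frontier (eff_dom L).
        filterlim (\<lambda>x. norm (gradient (\<lambda>y. real_of_ereal (L y)) x)) at_top
          (at y within interior (eff_dom L)))"

text \<open>For an extended-valued integrand, continuity in the second variable is continuity on the
  effective domain: a function that is finite on a closed proper subset and \<open>\<infinity>\<close> elsewhere is
  never continuous at the boundary of that subset.\<close>

definition caratheodory :: "'x measure \<Rightarrow> ('x \<Rightarrow> 'a::euclidean_space \<Rightarrow> ereal) \<Rightarrow> bool" where
  "caratheodory \<mu> R \<longleftrightarrow>
     (\<forall>y. (\<lambda>x. R x y) \<in> borel_measurable \<mu>) \<and>
     (AE x in \<mu>. continuous_on (eff_dom (R x)) (R x))"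

definition conjugate :: "('a::real_inner \<Rightarrow> ereal) \<Rightarrow> 'a \<Rightarrow> ereal" where
  "conjugate L z = (SUP y. ereal (z \<bullet> y) - L y)"

definition superpos :: "('x \<Rightarrow> 'a \<Rightarrow> ereal) \<Rightarrow> ('x \<Rightarrow> 'a) \<Rightarrow> 'x \<Rightarrow> real" where
  "superpos R w x = real_of_ereal (R x (w x))"

definition grad_superpos ::
    "('x \<Rightarrow> 'a::real_inner \<Rightarrow> ereal) \<Rightarrow> ('x \<Rightarrow> 'a) \<Rightarrow> 'x \<Rightarrow> 'a" where
  "grad_superpos R w x = gradient (\<lambda>y. real_of_ereal (R x y)) (w x)"

definition bregman ::
    "('x \<Rightarrow> 'a::real_inner \<Rightarrow> ereal) \<Rightarrow> ('x \<Rightarrow> 'a) \<Rightarrow> ('x \<Rightarrow> 'a) \<Rightarrow> 'x \<Rightarrow> real" where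
  "bregman R u v x = superpos R u x - superpos R v x - grad_superpos R v x \<bullet> (u x - v x)"

definition continuous_L2_L1 ::
    "'x measure \<Rightarrow> ('x \<Rightarrow> 'a::euclidean_space) set \<Rightarrow> (('x \<Rightarrow> 'a) \<Rightarrow> 'x \<Rightarrow> real) \<Rightarrow> bool" where
  "continuous_L2_L1 \<mu> X T \<longleftrightarrow>
     (\<forall>w\<in>X. integrable \<mu> (T w)) \<and>
     (\<forall>w\<in>X. \<forall>\<epsilon>>0. \<exists>\<delta>>0. \<forall>w'\<in>X. L2_norm \<mu> (\<lambda>x. w' x - w x) < \<delta> \<longrightarrow>
        (\<integral>x. \<bar>T w' x - T w x\<bar> \<partial>\<mu>) < \<epsilon>)"


section \<open>Energies and Fortin operators\<close>

definition energy ::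
    "('v::real_normed_vector \<Rightarrow> 'v \<Rightarrow> real) \<Rightarrow> ('v \<Rightarrow>\<^sub>L real) \<Rightarrow> 'v \<Rightarrow> real" where
  "energy a F v = 1 / 2 * a v v - F v"

definition fortin_operator ::
    "('v::real_normed_vector \<Rightarrow> 'w \<Rightarrow> real) \<Rightarrow> 'v set \<Rightarrow> 'w set \<Rightarrow> real \<Rightarrow> ('v \<Rightarrow> 'v) \<Rightarrow> bool" where
  "fortin_operator b V\<^sub>h W\<^sub>h c P \<longleftrightarrow>
     bounded_linear P \<and> range P \<subseteq> V\<^sub>h \<and>
     (\<forall>v. norm (P v) \<le> c * norm v) \<and>
     (\<forall>v. \<forall>w\<in>W\<^sub>h. b (v - P v) w = 0)"

lemma frechet_derivative_energy:
  assumes bil: "bilinear a" and sym: "\<And>u v. a u v = a v u"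
    and bnd: "\<And>u v. a u v \<le> M * norm u * norm v"
  shows "frechet_derivative (energy a F) (at u) v = a u v - F v"
proof -
  have "norm (a x y) \<le> norm x * norm y * M" for x y
    using bnd[of x y] bnd[of "- x" y] bilinear_lneg[OF bil, of x y]
    by (simp add: abs_le_iff mult.commute mult.left_commute)
  then have bb: "bounded_bilinear a"
    using bil by (intro bounded_bilinear.intro)
      (auto simp: bilinear_ladd bilinear_radd bilinear_lmul bilinear_rmul)
  have "((\<lambda>v. 1 / 2 * a v v - F v) has_derivative (\<lambda>v. 1 / 2 * (a u v + a v u) - F v)) (at u)"
    by (intro has_derivative_diff has_derivative_mult_right
        bounded_bilinear.FDERIV[OF bb] has_derivative_ident
        bounded_linear.has_derivative[OF blinfun.bounded_linear_right])
  then have "(energy a F has_derivative (\<lambda>v. a u v - F v)) (at u)"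
    using sym[of _ u] by (simp add: energy_def[abs_def])
  then show ?thesis
    using frechet_derivative_at by metis
qed

end

theory Submission
  imports Defs
begin

text \<open>For a supercoercive Legendre function the conjugate is differentiable everywhere, its gradient
  at \<open>z\<close> is the unique minimizer of \<open>R(y) - z \<bullet> y\<close>, this minimizer lies in the interior of the domain, and
  the gradient of \<open>R\<close> there is \<open>z\<close>. Hence the latent iterates \<open>\<psi>\<^sup>k\<close> are the gradients of \<open>R\<close> at
  \<open>o\<^sup>k = \<nabla>R\<^sup>*(\<psi>\<^sup>k)\<close>, and Bregman divergences from \<open>o\<^sup>k\<close> are nonnegative. Testing the first equation
  of step \<open>k\<close> with \<open>u\<^sup>k - \<Pi> u\<^sup>*\<close> and using the Fortin property, the three-point identity gives
  \<open>\<alpha>\<^sub>k (E(u\<^sup>k) - E(\<Pi> u\<^sup>*)) \<le> D(o\<^sup>*, o\<^sup>k\<^sup>-\<^sup>1) - D(o\<^sup>*, o\<^sup>k)\<close>; testing with \<open>u\<^sup>k - u\<^sup>k\<^sup>-\<^sup>1\<close> shows that the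
  energies decrease. Telescoping bounds \<open>E(u\<^sup>l) - E(\<Pi> u\<^sup>*)\<close>, and expanding the quadratic energy at
  \<open>u\<^sup>*\<close> together with the variational inequality yields the estimate.\<close>

section \<open>Legendre functions on closed convex domains\<close>

text \<open>Shrinking towards an interior point \<open>p\<close> sends \<open>S\<close> into its
  interior and commutes with convex combinations, so the inequality known on the interior passes to
  the limit by continuity on \<open>S\<close>.\<close>

lemma convex_on_from_interior:
  fixes f :: "'a::euclidean_space \<Rightarrow> real"
  assumes S: "convex S" "interior S \<noteq> {}" and cont: "continuous_on S f"
    and conv: "convex_on (interior S) f"
  shows "convex_on S f"
proof (rule convex_onI)
  fix t :: real and x y
  assume t: "0 < t" "t < 1" and x: "x \<in> S" and y: "y \<in> S"
  obtain p where p: "p \<in> interior S" using S by auto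
  define e where "e n = inverse (real (Suc n))" for n
  have e: "0 < e n" "e n \<le> 1" for n by (auto simp: e_def field_simps)
  have e0: "e \<longlonglongrightarrow> 0" unfolding e_def by (rule LIMSEQ_inverse_real_of_nat)
  define s where "s z n = z - e n *\<^sub>R (z - p)" for z n
  have s_int: "s z n \<in> interior S" if "z \<in> S" for z n
    unfolding s_def using mem_interior_convex_shrink[OF S(1) p that e] .
  have f_lim: "(\<lambda>n. f (s z n)) \<longlonglongrightarrow> f z" if z: "z \<in> S" for z
  proof (rule continuous_on_tendsto_compose[OF cont _ z])
    have "(\<lambda>n. z - e n *\<^sub>R (z - p)) \<longlonglongrightarrow> z - 0 *\<^sub>R (z - p)"
      by (intro tendsto_intros e0)
    then show "s z \<longlonglongrightarrow> z" by (simp add: s_def[abs_def])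
    show "\<forall>\<^sub>F n in sequentially. s z n \<in> S"
      using s_int[OF z] interior_subset by (auto intro!: always_eventually)
  qed
  define z where "z = (1 - t) *\<^sub>R x + t *\<^sub>R y"
  have z: "z \<in> S" unfolding z_def using t by (intro convexD[OF S(1) x y]) auto
  have s_comb: "s z n = (1 - t) *\<^sub>R s x n + t *\<^sub>R s y n" for n
    by (simp add: s_def z_def algebra_simps)
  have "f z \<le> (1 - t) * f x + t * f y"
  proof (rule LIMSEQ_le[OF f_lim[OF z]])
    show "(\<lambda>n. (1 - t) * f (s x n) + t * f (s y n)) \<longlonglongrightarrow> (1 - t) * f x + t * f y"
      by (intro tendsto_intros f_lim x y)
    show "\<exists>N. \<forall>n\<ge>N. f (s z n) \<le> (1 - t) * f (s x n) + t * f (s y n)"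
      unfolding s_comb using t by (auto intro!: convex_onD[OF conv] s_int x y)
  qed
  then show "f ((1 - t) *\<^sub>R x + t *\<^sub>R y) \<le> (1 - t) * f x + t * f y"
    by (simp add: z_def)
qed (rule S)

text \<open>Convexity bounds the difference quotients along the segment by \<open>f y - f x\<close>,
  and their right limit at 0 is \<open>D \<bullet> (y - x)\<close>. The point \<open>y\<close> may
  lie on the boundary of \<open>S\<close>.\<close>

lemma convex_on_above_tangent_plane:
  fixes f :: "'a::real_inner \<Rightarrow> real"
  assumes conv: "convex_on S f" and x: "x \<in> S" and y: "y \<in> S" and D: "GDERIV f x :> D"
  shows "f x + D \<bullet> (y - x) \<le> f y"
proof -
  have "((\<lambda>t. f (x + t *\<^sub>R (y - x))) has_derivative (\<lambda>t. (t *\<^sub>R (y - x)) \<bullet> D)) (at 0)"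
    by (rule has_derivative_compose[of "\<lambda>t. x + t *\<^sub>R (y - x)" _ 0 UNIV f "\<lambda>h. h \<bullet> D"])
       (use D in \<open>auto simp: gderiv_def intro!: derivative_eq_intros\<close>)
  then have "((\<lambda>t. f (x + t *\<^sub>R (y - x))) has_real_derivative (D \<bullet> (y - x))) (at 0)"
    by (rule has_derivative_imp_has_field_derivative) (simp add: inner_commute)
  then have "((\<lambda>t. (f (x + t *\<^sub>R (y - x)) - f x) / t) \<longlongrightarrow> D \<bullet> (y - x)) (at_right 0)"
    by (auto simp: has_field_derivative_iff intro: tendsto_mono[OF at_le])
  then have "D \<bullet> (y - x) \<le> f y - f x"
  proof (rule tendsto_upperbound)
    have "(f (x + t *\<^sub>R (y - x)) - f x) / t \<le> f y - f x" if "0 < t" "t < 1" for t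
    proof -
      have "f (x + t *\<^sub>R (y - x)) \<le> (1 - t) * f x + t * f y"
        using convex_onD[OF conv _ _ x y, of t] that by (simp add: algebra_simps)
      then show ?thesis using that by (simp add: field_simps)
    qed
    then show "\<forall>\<^sub>F t in at_right 0. (f (x + t *\<^sub>R (y - x)) - f x) / t \<le> f y - f x"
      unfolding eventually_at_right_field by (intro exI[of _ 1]) auto
  qed simp
  then show ?thesis by simp
qed

lemma gradient_eqI: "GDERIV f x :> D \<Longrightarrow> gradient f x = D"
  unfolding gradient_def
proof (rule the_equality)
  fix D' assume "GDERIV f x :> D" "GDERIV f x :> D'"
  then have "(\<lambda>h. h \<bullet> D') = (\<lambda>h. h \<bullet> D)" unfolding gderiv_def by (rule has_derivative_unique[rotated])
  then show "D' = D" by (metis inner_eq_zero_iff inner_diff_right right_minus_eq)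
qed

lemma GDERIV_gradient:
  fixes f :: "'a::euclidean_space \<Rightarrow> real"
  assumes "f differentiable at x"
  shows "GDERIV f x :> gradient f x"
proof -
  obtain D where D: "(f has_derivative D) (at x)" using assms by (auto simp: differentiable_def)
  then have lin: "linear D" using has_derivative_linear by blast
  \<comment> \<open>The Riesz representative of the derivative, in coordinates.\<close>
  define g where "g = (\<Sum>i\<in>Basis. D i *\<^sub>R i)"
  have "D h = h \<bullet> g" for h
  proof -
    have "D h = D (\<Sum>i\<in>Basis. (h \<bullet> i) *\<^sub>R i)" by (simp add: euclidean_representation)
    also have "\<dots> = (\<Sum>i\<in>Basis. (h \<bullet> i) * D i)" by (simp add: linear_sum[OF lin] linear_scale[OF lin])
    finally show ?thesis by (simp add: g_def inner_sum_right mult.commute)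
  qed
  then have "D = (\<lambda>h. h \<bullet> g)" by (rule ext)
  then have "GDERIV f x :> g" using D by (simp add: gderiv_def)
  then show ?thesis using gradient_eqI by metis
qed

text \<open>The finite part of a supercoercive Legendre integrand on its domain; this keeps the
  optimization arguments in the reals. Supercoercivity becomes a linear lower bound of every slope
  \<open>r\<close> outside some ball.\<close>

locale legendre_on =
  fixes S :: "'a::euclidean_space set" and f :: "'a \<Rightarrow> real"
  assumes closed: "closed S" and int_ne: "interior S \<noteq> {}" and conv_S: "convex S"
    and cont: "continuous_on S f"
    and strict: "strictly_convex_on (interior S) f"
    and diff: "\<And>y. y \<in> interior S \<Longrightarrow> f differentiable at y"
    and steep: "\<And>y. y \<in> frontier S \<Longrightarrow>
      filterlim (\<lambda>x. norm (gradient f x)) at_top (at y within interior S)"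
    and supercoercive: "\<And>r. \<exists>c. \<forall>y\<in>S. c \<le> norm y \<longrightarrow> r * norm y \<le> f y"
begin

lemma convex: "convex_on S f"
proof (rule convex_on_from_interior[OF conv_S int_ne cont])
  show "convex_on (interior S) f"
  proof (rule convex_onI)
    fix t :: real and x y assume *: "0 < t" "t < 1" "x \<in> interior S" "y \<in> interior S"
    show "f ((1 - t) *\<^sub>R x + t *\<^sub>R y) \<le> (1 - t) * f x + t * f y"
    proof (cases "x = y")
      case True
      then show ?thesis by (simp add: scaleR_left_distrib[symmetric] distrib_right[symmetric])
    next
      case False
      then show ?thesis using strict * unfolding strictly_convex_on_def by (blast intro: less_imp_le)
    qed
  qed (use strict in \<open>simp add: strictly_convex_on_def\<close>)
qed

lemma minimizer_exists:
  obtains y where "y \<in> S" "\<And>y'. y' \<in> S \<Longrightarrow> f y - z \<bullet> y \<le> f y' - z \<bullet> y'"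
proof -
  obtain p where p: "p \<in> S" using int_ne interior_subset by blast
  define m where "m = \<bar>f p - z \<bullet> p\<bar>"
  \<comment> \<open>One unit of slope beyond \<open>norm z\<close> leaves a surplus
    \<open>norm y\<close> after Cauchy-Schwarz.\<close>
  obtain c where c: "\<And>y. y \<in> S \<Longrightarrow> c \<le> norm y \<Longrightarrow> (norm z + 1) * norm y \<le> f y"
    using supercoercive by metis
  \<comment> \<open>Outside this ball the coercive bound applies (\<open>c\<close>) and the surplus
    exceeds the objective at \<open>p\<close> (\<open>m\<close>); \<open>norm p\<close> makes
    \<open>p\<close> a competitor inside.\<close>
  define r where "r = max (max c m) (norm p)"
  have "\<exists>y\<in>S \<inter> cball 0 r. \<forall>y'\<in>S \<inter> cball 0 r. f y - z \<bullet> y \<le> f y' - z \<bullet> y'"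
  proof (rule continuous_attains_inf)
    show "compact (S \<inter> cball 0 r)" using closed by (simp add: closed_Int_compact)
    show "S \<inter> cball 0 r \<noteq> {}" using p by (auto simp: r_def)
    show "continuous_on (S \<inter> cball 0 r) (\<lambda>y. f y - z \<bullet> y)"
      by (intro continuous_intros continuous_on_subset[OF cont]) auto
  qed
  then obtain y where y: "y \<in> S" and min: "\<And>y'. y' \<in> S \<Longrightarrow> norm y' \<le> r \<Longrightarrow> f y - z \<bullet> y \<le> f y' - z \<bullet> y'"
    by auto
  show thesis
  proof (rule that[OF y])
    fix y' assume y': "y' \<in> S"
    show "f y - z \<bullet> y \<le> f y' - z \<bullet> y'"
    proof (cases "norm y' \<le> r")
      case False
      have "f y - z \<bullet> y \<le> f p - z \<bullet> p" using min[OF p] by (simp add: r_def)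
      also have "\<dots> \<le> norm y'" using False by (simp add: r_def m_def)
      also have "\<dots> \<le> (norm z + 1) * norm y' - norm z * norm y'" by (simp add: algebra_simps)
      also have "\<dots> \<le> f y' - z \<bullet> y'"
        using c[OF y'] False norm_cauchy_schwarz[of z y'] by (intro diff_mono) (auto simp: r_def)
      finally show ?thesis .
    qed (rule min[OF y'])
  qed
qed

text \<open>At a boundary minimizer \<open>y\<close> the tangent planes at the points \<open>x\<close> of a segment from an interior
  point \<open>p\<close> to \<open>y\<close>, evaluated on a small ball around \<open>p\<close>, would force the slope of the objective
  towards \<open>p\<close> to be negative, because the gradients blow up.\<close>

lemma minimizer_interior:
  assumes y: "y \<in> S" and min: "\<And>y'. y' \<in> S \<Longrightarrow> f y - z \<bullet> y \<le> f y' - z \<bullet> y'"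
  shows "y \<in> interior S"
proof (rule ccontr)
  assume "y \<notin> interior S"
  then have fr: "y \<in> frontier S" using y closed by (simp add: frontier_def)
  obtain p where p: "p \<in> interior S" using int_ne by auto
  obtain r where r: "0 < r" "cball p r \<subseteq> S" using p mem_interior_cball by blast
  define k where "k w = f w - z \<bullet> w" for w
  define G where "G w = gradient f w - z" for w
  have tangent: "k x + G x \<bullet> (w - x) \<le> k w" if "x \<in> interior S" "w \<in> S" for x w
    using convex_on_above_tangent_plane[OF convex _ that(2) GDERIV_gradient[OF diff[OF that(1)]]]
      that(1) interior_subset
    by (auto simp: k_def G_def inner_diff_left inner_diff_right)
  have "continuous_on (cball p r) k"
    unfolding k_def by (intro continuous_intros continuous_on_subset[OF cont r(2)])
  then have "bounded (k ` cball p r)"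
    by (intro compact_imp_bounded compact_continuous_image) auto
  then obtain m where m: "\<And>w. w \<in> cball p r \<Longrightarrow> k w \<le> m"
    unfolding bounded_iff by (force simp: abs_le_iff)
  define x where "x t = y + t *\<^sub>R (p - y)" for t
  have x_int: "x t \<in> interior S" if "0 < t" "t \<le> 1" for t
    using mem_interior_convex_shrink[OF conv_S p y that] by (simp add: x_def algebra_simps)
  have py: "p \<noteq> y" using p fr by (auto simp: frontier_def)
  have "(x \<longlongrightarrow> y + 0 *\<^sub>R (p - y)) (at_right 0)"
    unfolding x_def by (intro tendsto_intros)
  moreover have "\<forall>\<^sub>F t in at_right 0. x t \<in> interior S \<and> x t \<noteq> y"
    unfolding eventually_at_right_field using x_int py
    by (intro exI[of _ 1]) (auto simp: x_def)
  ultimately have "filterlim x (at y within interior S) (at_right 0)"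
    by (simp add: filterlim_at)
  then have "filterlim (\<lambda>t. norm (gradient f (x t))) at_top (at_right 0)"
    by (rule filterlim_compose[OF steep[OF fr]])
  \<comment> \<open>The threshold is such that subtracting \<open>z\<close> still leaves
    \<open>norm (G (x t))\<close> above \<open>(m - k y) / r\<close>.\<close>
  then have "\<forall>\<^sub>F t in at_right 0. (m - k y) / r + norm z < norm (gradient f (x t))"
    by (simp add: filterlim_at_top_dense)
  moreover have "\<forall>\<^sub>F t in at_right 0. t < (1::real)" "\<forall>\<^sub>F t in at_right 0. (0::real) < t"
    by (auto simp: eventually_at_right_field intro!: exI[of _ 1])
  ultimately have "\<forall>\<^sub>F t in at_right 0. (m - k y) / r + norm z < norm (gradient f (x t)) \<and> t < 1 \<and> 0 < t"
    by eventually_elim auto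
  then obtain t where t: "(m - k y) / r + norm z < norm (gradient f (x t))" "t < 1" "0 < t"
    using eventually_happens'[of "at_right (0::real)"] by auto
  have ky: "k y \<le> k (x t)"
    unfolding k_def using x_int[of t] t interior_subset[of S] by (intro min) auto
  have "(m - k y) / r < norm (G (x t))"
    using t(1) norm_triangle_ineq2[of "gradient f (x t)" z] by (simp add: G_def)
  then have big: "m - k y < r * norm (G (x t))"
    using r by (simp add: field_simps)
  \<comment> \<open>Moving from \<open>p\<close> along the gradient direction gains the full
    \<open>r * norm (G (x t))\<close>; since \<open>k w \<le> m\<close>, the slope towards
    \<open>p\<close> must compensate by being negative.\<close>
  define w where "w = p + r *\<^sub>R sgn (G (x t))"
  have w: "w \<in> cball p r" using r by (simp add: w_def dist_norm norm_sgn)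
  have "k (x t) + G (x t) \<bullet> (w - x t) \<le> m"
    using tangent[OF x_int, of t w] m[OF w] w r t by force
  moreover have "G (x t) \<bullet> (w - x t) = (1 - t) * (G (x t) \<bullet> (p - y)) + r * norm (G (x t))"
  proof -
    have "w - x t = (1 - t) *\<^sub>R (p - y) + r *\<^sub>R sgn (G (x t))"
      by (simp add: w_def x_def algebra_simps)
    moreover have "G (x t) \<bullet> sgn (G (x t)) = norm (G (x t))"
      by (cases "G (x t) = 0") (auto simp: sgn_div_norm power2_norm_eq_inner[symmetric] power2_eq_square)
    ultimately show ?thesis by (simp add: inner_add_right)
  qed
  ultimately have "(1 - t) * (G (x t) \<bullet> (p - y)) < 0" using big ky by linarith
  then have "G (x t) \<bullet> (p - y) < 0" using t by (simp add: mult_less_0_iff)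
  \<comment> \<open>The same tangent plane evaluated at \<open>y\<close> now puts
    \<open>k (x t)\<close> strictly below \<open>k y\<close>, against minimality.\<close>
  moreover have "k (x t) + G (x t) \<bullet> (y - x t) \<le> k y"
    using tangent x_int t y by simp
  then have "k (x t) \<le> k y + t * (G (x t) \<bullet> (p - y))"
    by (simp add: x_def inner_diff_right algebra_simps)
  ultimately show False using ky t mult_pos_neg[of t "G (x t) \<bullet> (p - y)"] by linarith
qed

text \<open>Strict convexity is available on the interior only, so both minimizers are first placed
  there; then their midpoint would do better.\<close>

lemma minimizer_unique:
  assumes "y \<in> S" "\<And>w. w \<in> S \<Longrightarrow> f y - z \<bullet> y \<le> f w - z \<bullet> w"
    and "y' \<in> S" "f y' - z \<bullet> y' \<le> f y - z \<bullet> y"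
  shows "y' = y"
proof (rule ccontr)
  assume ne: "y' \<noteq> y"
  have int: "y \<in> interior S" "y' \<in> interior S"
    using assms by (auto intro!: minimizer_interior intro: order_trans)
  define c where "c = (1 - 1 / 2) *\<^sub>R y + (1 / 2 :: real) *\<^sub>R y'"
  have "f c < (1 - 1 / 2) * f y + 1 / 2 * f y'"
    using strict[unfolded strictly_convex_on_def, THEN conjunct2, rule_format, OF int, of "1 / 2"] ne
    unfolding c_def by simp
  moreover have "c \<in> S" unfolding c_def by (intro convexD[OF conv_S] assms) auto
  then have "f y - z \<bullet> y \<le> f c - z \<bullet> c" using assms by auto
  moreover have "z \<bullet> c = 1 / 2 * (z \<bullet> y) + 1 / 2 * (z \<bullet> y')"
    by (simp add: c_def inner_add_right)
  ultimately show False using assms by simp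
qed

text \<open>By convexity, the gap on a sphere around the strict minimizer grows linearly outside it, so a
  perturbation of the slope smaller than the growth rate keeps minimizers inside the sphere.\<close>

lemma minimizer_continuous:
  assumes y: "y \<in> S" and min: "\<And>w. w \<in> S \<Longrightarrow> f y - z \<bullet> y \<le> f w - z \<bullet> w" and \<epsilon>: "0 < \<epsilon>"
  obtains \<eta> where "0 < \<eta>"
    "\<And>z' y'. y' \<in> S \<Longrightarrow> f y' - z' \<bullet> y' \<le> f y - z' \<bullet> y \<Longrightarrow> norm (z' - z) < \<eta> \<Longrightarrow> norm (y' - y) < \<epsilon>"
proof -
  define k where "k w = f w - z \<bullet> w" for w
  obtain \<delta> where \<delta>: "0 < \<delta>" "\<And>w. w \<in> S \<inter> sphere y \<epsilon> \<Longrightarrow> k y + \<delta> \<le> k w"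
  proof (cases "S \<inter> sphere y \<epsilon> = {}")
    \<comment> \<open>The sphere may miss \<open>S\<close> altogether; then any positive gap
      serves.\<close>
    case True
    then show ?thesis using that[of 1] by simp
  next
    case False
    have "\<exists>w\<in>S \<inter> sphere y \<epsilon>. \<forall>w'\<in>S \<inter> sphere y \<epsilon>. k w \<le> k w'"
    proof (rule continuous_attains_inf[OF _ False])
      show "compact (S \<inter> sphere y \<epsilon>)" using closed by (simp add: closed_Int_compact)
      show "continuous_on (S \<inter> sphere y \<epsilon>) k"
        unfolding k_def by (intro continuous_intros continuous_on_subset[OF cont]) auto
    qed
    then obtain w where w: "w \<in> S \<inter> sphere y \<epsilon>" "\<And>w'. w' \<in> S \<inter> sphere y \<epsilon> \<Longrightarrow> k w \<le> k w'" by blast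
    have "w \<noteq> y" using w \<epsilon> by auto
    then have "k y < k w"
      using minimizer_unique[OF y min, of w] w unfolding k_def by force
    then show ?thesis using that[of "k w - k y"] w by simp
  qed
  show thesis
  proof (rule that)
    show "0 < \<delta> / \<epsilon>" using \<delta> \<epsilon> by simp
    fix z' y' assume y': "y' \<in> S" and le: "f y' - z' \<bullet> y' \<le> f y - z' \<bullet> y" and near: "norm (z' - z) < \<delta> / \<epsilon>"
    show "norm (y' - y) < \<epsilon>"
    proof (rule ccontr)
      assume "\<not> norm (y' - y) < \<epsilon>"
      then have far: "\<epsilon> \<le> norm (y' - y)" by simp
      \<comment> \<open>This scaling puts \<open>w\<close> on the sphere, where the gap
        \<open>\<delta>\<close> is available.\<close>
      define t where "t = \<epsilon> / norm (y' - y)"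
      have t: "0 < t" "t \<le> 1" using far \<epsilon> by (auto simp: t_def divide_simps)
      define w where "w = (1 - t) *\<^sub>R y + t *\<^sub>R y'"
      have "w - y = t *\<^sub>R (y' - y)" by (simp add: w_def algebra_simps)
      moreover have "y' \<noteq> y" using far \<epsilon> by auto
      ultimately have "norm (w - y) = \<epsilon>" using \<epsilon> by (simp add: t_def)
      moreover have "w \<in> S" unfolding w_def using t by (intro convexD[OF conv_S] y y') auto
      ultimately have "k y + \<delta> \<le> k w" by (intro \<delta>) (simp add: dist_norm norm_minus_commute)
      moreover have "f w \<le> (1 - t) * f y + t * f y'"
        unfolding w_def using t by (intro convex_onD[OF convex] y y') auto
      then have "k w \<le> k y + t * (k y' - k y)"
        by (simp add: k_def w_def inner_add_right algebra_simps)
      ultimately have "\<delta> \<le> t * (k y' - k y)" by simp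
      also have "k y' - k y \<le> (z' - z) \<bullet> (y' - y)"
        using le by (simp add: k_def inner_diff_left inner_diff_right)
      also have "\<dots> \<le> norm (z' - z) * norm (y' - y)" by (rule norm_cauchy_schwarz)
      also have "t * (norm (z' - z) * norm (y' - y)) = \<epsilon> * norm (z' - z)"
        using far \<epsilon> by (auto simp: t_def)
      finally have "\<delta> \<le> \<epsilon> * norm (z' - z)" using t by simp
      then show False using near \<epsilon> by (simp add: field_simps)
    qed
  qed
qed

text \<open>Optimality of \<open>y'\<close> for \<open>z'\<close> and of \<open>y\<close> for
  \<open>z\<close> squeezes the first-order remainder between 0 and
  \<open>(z' - z) \<bullet> (y' - y)\<close>, and \<open>y'\<close> tends to \<open>y\<close>. The
  conjugate enters only through its value at minimizers, which keeps the supremum out of the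
  argument.\<close>

lemma GDERIV_conjugate:
  assumes y: "y \<in> S" and min: "\<And>w. w \<in> S \<Longrightarrow> f y - z \<bullet> y \<le> f w - z \<bullet> w"
    and conj: "\<And>z y. y \<in> S \<Longrightarrow> (\<And>w. w \<in> S \<Longrightarrow> f y - z \<bullet> y \<le> f w - z \<bullet> w) \<Longrightarrow> g z = z \<bullet> y - f y"
  shows "GDERIV g z :> y"
  unfolding gderiv_def has_derivative_at_within
proof (intro conjI)
  show "bounded_linear (\<lambda>h. h \<bullet> y)" by (rule bounded_linear_inner_left)
  show "((\<lambda>z'. (g z' - g z - (z' - z) \<bullet> y) /\<^sub>R norm (z' - z)) \<longlongrightarrow> 0) (at z)"
    unfolding tendsto_iff eventually_at
  proof (intro allI impI)
    fix \<epsilon> :: real assume "0 < \<epsilon>"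
    then obtain \<eta> where \<eta>: "0 < \<eta>" "\<And>z' y'. y' \<in> S \<Longrightarrow> f y' - z' \<bullet> y' \<le> f y - z' \<bullet> y \<Longrightarrow>
        norm (z' - z) < \<eta> \<Longrightarrow> norm (y' - y) < \<epsilon>"
      using minimizer_continuous[OF y min] by metis
    have "dist ((g z' - g z - (z' - z) \<bullet> y) /\<^sub>R norm (z' - z)) 0 < \<epsilon>"
      if ne: "z' \<noteq> z" and near: "dist z' z < \<eta>" for z'
    proof -
      obtain y' where y': "y' \<in> S" "\<And>w. w \<in> S \<Longrightarrow> f y' - z' \<bullet> y' \<le> f w - z' \<bullet> w"
        using minimizer_exists by metis
      have close: "norm (y' - y) < \<epsilon>" using \<eta>(2)[OF y'(1) y'(2)[OF y]] near by (simp add: dist_norm)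
      define \<rho> where "\<rho> = g z' - g z - (z' - z) \<bullet> y"
      have "\<rho> = z' \<bullet> y' - f y' - (z' \<bullet> y - f y)"
        using conj[OF y' ] conj[OF y min] by (simp add: \<rho>_def inner_diff_left)
      then have "0 \<le> \<rho>" "\<rho> \<le> (z' - z) \<bullet> (y' - y)"
        using y'(2)[OF y] min[OF y'(1)] by (auto simp: inner_diff_left inner_diff_right)
      moreover have "\<dots> \<le> norm (z' - z) * norm (y' - y)" by (rule norm_cauchy_schwarz)
      moreover have "\<dots> < norm (z' - z) * \<epsilon>" using close ne by simp
      ultimately have "\<bar>\<rho>\<bar> < norm (z' - z) * \<epsilon>" by linarith
      then show ?thesis using ne unfolding \<rho>_def[symmetric]
        by (simp add: abs_mult divide_inverse[symmetric] mult.commute[of "inverse _"]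
            pos_divide_less_eq mult.commute)
    qed
    then show "\<exists>\<eta>>0. \<forall>z'\<in>UNIV. z' \<noteq> z \<and> dist z' z < \<eta> \<longrightarrow>
        dist ((g z' - g z - (z' - z) \<bullet> y) /\<^sub>R norm (z' - z)) 0 < \<epsilon>"
      using \<eta>(1) by blast
  qed
qed

text \<open>Fermat's rule applies because the minimizer is interior.\<close>

lemma gradient_minimizer:
  assumes y: "y \<in> S" and min: "\<And>w. w \<in> S \<Longrightarrow> f y - z \<bullet> y \<le> f w - z \<bullet> w"
  shows "gradient f y = z"
proof -
  have int: "y \<in> interior S" using minimizer_interior[OF y min] .
  have "((\<lambda>w. f w - z \<bullet> w) has_derivative (\<lambda>h. h \<bullet> gradient f y - z \<bullet> h)) (at y)"
    using GDERIV_gradient[OF diff[OF int]] unfolding gderiv_def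
    by (auto intro!: derivative_eq_intros)
  moreover have "f y - z \<bullet> y \<le> f w - z \<bullet> w" if "w \<in> interior S" for w
    using min that interior_subset by blast
  ultimately have "(\<lambda>h. h \<bullet> gradient f y - z \<bullet> h) = (\<lambda>h. 0)"
    using int by (intro differential_zero_maxmin[where S = "interior S" and x = y]) auto
  then have "h \<bullet> (gradient f y - z) = 0" for h
    by (metis inner_commute inner_diff_right)
  then show ?thesis by (metis inner_eq_zero_iff right_minus_eq)
qed

end

text \<open>Properness makes \<open>L\<close> finite on its effective domain, so its properties
  transfer to the real-valued restriction.\<close>

lemma legendre_on_eff_dom:
  fixes L :: "'a::euclidean_space \<Rightarrow> ereal"
  assumes L: "legendre L" and cont: "continuous_on (eff_dom L) L"
    and dom: "closed (eff_dom L)" "convex (eff_dom L)"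
    and coercive: "((\<lambda>y. L y / ereal (norm y)) \<longlongrightarrow> \<infinity>) at_infinity"
  shows "legendre_on (eff_dom L) (\<lambda>y. real_of_ereal (L y))"
proof
  have fin: "\<bar>L y\<bar> \<noteq> \<infinity>" if "y \<in> eff_dom L" for y
    using L that by (auto simp: legendre_def proper_fun_def eff_dom_def)
  show "continuous_on (eff_dom L) (\<lambda>y. real_of_ereal (L y))"
    using cont fin continuous_on_iff_real[of "eff_dom L" L] by (auto simp: comp_def)
  show "\<exists>c. \<forall>y\<in>eff_dom L. c \<le> norm y \<longrightarrow> r * norm y \<le> real_of_ereal (L y)" for r
  proof -
    obtain c where c: "\<And>y. c \<le> norm y \<Longrightarrow> ereal r < L y / ereal (norm y)"
      using coercive unfolding tendsto_PInfty eventually_at_infinity by metis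
    \<comment> \<open>The bound 1 keeps \<open>norm y\<close> positive, so the quotient can be
      cleared.\<close>
    have "r * norm y \<le> real_of_ereal (L y)" if y: "y \<in> eff_dom L" "max c 1 \<le> norm y" for y
    proof -
      obtain s where s: "L y = ereal s" using fin[OF y(1)] by auto
      have "0 < norm y" using y(2) by linarith
      then show ?thesis using c[of y] y s by (simp add: field_simps)
    qed
    then show ?thesis by blast
  qed
qed (use L dom in \<open>auto simp: legendre_def\<close>)

text \<open>The supremum in the conjugate is attained at the unique minimizer of the tilted
  function, which is therefore the gradient of the conjugate. The last claim reaches boundary points
  \<open>w\<close> too, as fields in \<open>\<O>\<close> may take boundary values.\<close>

lemma gradient_conjugate:
  fixes L :: "'a::euclidean_space \<Rightarrow> ereal" and z :: 'a
  assumes L: "legendre L" and cont: "continuous_on (eff_dom L) L"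
    and dom: "closed (eff_dom L)" "convex (eff_dom L)"
    and coercive: "((\<lambda>y. L y / ereal (norm y)) \<longlongrightarrow> \<infinity>) at_infinity"
  defines "y \<equiv> gradient (\<lambda>z. real_of_ereal (conjugate L z)) z"
  shows "y \<in> eff_dom L" "gradient (\<lambda>y. real_of_ereal (L y)) y = z"
    "\<And>w. w \<in> eff_dom L \<Longrightarrow> real_of_ereal (L y) + z \<bullet> (w - y) \<le> real_of_ereal (L w)"
proof -
  let ?f = "\<lambda>y. real_of_ereal (L y)"
  interpret legendre_on "eff_dom L" ?f by (rule legendre_on_eff_dom[OF L cont dom coercive])
  have fin: "L w = ereal (?f w)" if "w \<in> eff_dom L" for w
    using L that by (cases "L w") (auto simp: legendre_def proper_fun_def eff_dom_def)
  have conj: "real_of_ereal (conjugate L \<zeta>) = \<zeta> \<bullet> v - ?f v"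
    if v: "v \<in> eff_dom L" and min: "\<And>w. w \<in> eff_dom L \<Longrightarrow> ?f v - \<zeta> \<bullet> v \<le> ?f w - \<zeta> \<bullet> w" for \<zeta> v
  proof -
    have "conjugate L \<zeta> = ereal (\<zeta> \<bullet> v - ?f v)"
      unfolding conjugate_def
    proof (rule antisym)
      show "(SUP w. ereal (\<zeta> \<bullet> w) - L w) \<le> ereal (\<zeta> \<bullet> v - ?f v)"
      proof (rule SUP_least)
        fix w
        show "ereal (\<zeta> \<bullet> w) - L w \<le> ereal (\<zeta> \<bullet> v - ?f v)"
        proof (cases "w \<in> eff_dom L")
          case True
          show ?thesis using min[OF True] by (subst fin[OF True]) simp
        \<comment> \<open>Outside the domain the supremum only sees minus infinity.\<close>
        qed (auto simp: eff_dom_def)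
      qed
      have "ereal (\<zeta> \<bullet> v - ?f v) = ereal (\<zeta> \<bullet> v) - L v" by (subst fin[OF v]) simp
      also have "\<dots> \<le> (SUP w. ereal (\<zeta> \<bullet> w) - L w)" by (rule SUP_upper) simp
      finally show "ereal (\<zeta> \<bullet> v - ?f v) \<le> (SUP w. ereal (\<zeta> \<bullet> w) - L w)" .
    qed
    then show ?thesis by simp
  qed
  obtain v where v: "v \<in> eff_dom L" "\<And>w. w \<in> eff_dom L \<Longrightarrow> ?f v - z \<bullet> v \<le> ?f w - z \<bullet> w"
    using minimizer_exists by metis
  have "GDERIV (\<lambda>z. real_of_ereal (conjugate L z)) z :> v"
    by (rule GDERIV_conjugate[OF v]) (auto intro: conj)
  then have "y = v" unfolding y_def by (rule gradient_eqI)
  then show "y \<in> eff_dom L" "gradient ?f y = z"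
    using v(1) gradient_minimizer[OF v] by simp_all
  show "?f y + z \<bullet> (w - y) \<le> ?f w" if "w \<in> eff_dom L" for w
    using v(2)[OF that] \<open>y = v\<close> by (simp add: inner_diff_right)
qed


section \<open>Completeness of Hausdorff measures\<close>

text \<open>The Bregman integrand is only known to agree almost everywhere with a measurable function; the
  Bochner integral of a nonmeasurable function is 0, so completeness is what makes it meaningful.\<close>

lemma complete_measure_hausdorff: "complete_measure (hausdorff_measure s :: 'a::metric_space measure)"
proof
  fix A B :: "'a set" assume BA: "B \<subseteq> A" and A: "A \<in> null_sets (hausdorff_measure s)"
  let ?h = "hausdorff_outer s :: 'a set \<Rightarrow> ennreal"
  have pos: "positive UNIV ?h" and mono: "increasing UNIV ?h" and csub: "countably_subadditive UNIV ?h"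
    using outer_measure_space_hausdorff[of s, where 'a = 'a] by (auto simp: outer_measure_space_def)
  interpret sigma_algebra "UNIV :: 'a set" UNIV
    using sigma_algebra_Pow[of "UNIV :: 'a set"] by simp
  have sub: "subadditive UNIV ?h"
    by (rule countably_subadditive_subadditive[OF pos csub])
  have le: "?h X \<le> ?h Y" if "X \<subseteq> Y" for X Y
    using mono that by (simp add: increasing_def)
  have "?h A = 0"
    using A emeasure_hausdorff_measure[of A s] by (auto simp: null_sets_def)
  then have null: "?h (X \<inter> B) = 0" for X using le[of "X \<inter> B" A] BA by auto
  \<comment> \<open>With \<open>X \<inter> B\<close> null, the Caratheodory criterion reduces to
    monotonicity and subadditivity.\<close>
  have "?h (X \<inter> B) + ?h (X - B) = ?h X" for X
  proof (rule antisym)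
    show "?h (X \<inter> B) + ?h (X - B) \<le> ?h X" using null le[of "X - B" X] by simp
    have "?h ((X \<inter> B) \<union> (X - B)) \<le> ?h (X \<inter> B) + ?h (X - B)"
      by (rule subadditiveD[OF sub]) auto
    then show "?h X \<le> ?h (X \<inter> B) + ?h (X - B)" by (simp add: Int_Diff_Un)
  qed
  then show "B \<in> sets (hausdorff_measure s)"
    by (simp add: sets_hausdorff_measure lambda_system_eq)
qed

lemma complete_measure_restrict_space:
  assumes "complete_measure M" "S \<in> sets M"
  shows "complete_measure (restrict_space M S)"
proof -
  interpret complete_measure M by fact
  show ?thesis
  proof
    fix A B assume "B \<subseteq> A" "A \<in> null_sets (restrict_space M S)"
    then have "B \<subseteq> S" "B \<in> sets M"
      using complete[of B A] assms(2) by (auto simp: null_sets_restrict_space)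
    then show "B \<in> sets (restrict_space M S)"
      using assms(2) by (simp add: sets_restrict_space_iff)
  qed
qed

lemma (in complete_measure) borel_measurable_AE_eq:
  fixes f g :: "'a \<Rightarrow> 'b::topological_space"
  assumes f: "f \<in> borel_measurable M" and eq: "AE x in M. f x = g x"
  shows "g \<in> borel_measurable M"
proof (rule measurableI)
  fix T :: "'b set" assume "T \<in> sets borel"
  then have T: "f -` T \<inter> space M \<in> sets M" using f by (rule measurable_sets[rotated])
  show "g -` T \<inter> space M \<in> sets M"
    by (rule in_sets_AE[OF _ T]) (use eq in \<open>auto elim: eventually_mono\<close>)
qed simp


section \<open>Pairing square-integrable with essentially bounded fields\<close>

text \<open>The integrand is dominated by a multiple of \<open>1 + (norm (f x))\<^sup>2\<close>,
  whose constant part is integrable because the measure is finite.\<close>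

lemma (in finite_measure) integrable_inner_L2_Linf:
  fixes f w :: "'a \<Rightarrow> 'b::euclidean_space"
  assumes f: "f \<in> L2_space M" and w: "w \<in> Linf_space M"
  shows "integrable M (\<lambda>x. f x \<bullet> w x)"
proof -
  have [measurable]: "f \<in> borel_measurable M" "w \<in> borel_measurable M"
    using f w by (auto simp: L2_space_def Linf_space_def)
  obtain c where c: "AE x in M. norm (w x) \<le> c" using w by (auto simp: Linf_space_def)
  show ?thesis
  proof (rule Bochner_Integration.integrable_bound[where f = "\<lambda>x. \<bar>c\<bar> * (1 + (norm (f x))\<^sup>2)"])
    show "integrable M (\<lambda>x. \<bar>c\<bar> * (1 + (norm (f x))\<^sup>2))" using f by (auto simp: L2_space_def)
    show "AE x in M. norm (f x \<bullet> w x) \<le> norm (\<bar>c\<bar> * (1 + (norm (f x))\<^sup>2))"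
      using c
    proof eventually_elim
      case (elim x)
      \<comment> \<open>From the nonnegativity of the square of
        \<open>norm (f x) - 1\<close>.\<close>
      have "norm (f x) \<le> 1 + (norm (f x))\<^sup>2"
        using zero_le_power2[of "norm (f x) - 1"] norm_ge_zero[of "f x"]
        unfolding power2_diff one_power2 mult_1_right by linarith
      moreover have "norm (w x) \<le> \<bar>c\<bar>" using elim by linarith
      ultimately have "norm (f x) * norm (w x) \<le> (1 + (norm (f x))\<^sup>2) * \<bar>c\<bar>"
        by (intro mult_mono) auto
      then show ?case
        using Cauchy_Schwarz_ineq2[of "f x" "w x"] by (simp add: abs_mult mult.commute)
    qed
  qed simp
qed

text \<open>Makes the latent increments admissible test functions in the second discrete
  equation.\<close>

lemma findim_subspace_Linf_diff:
  assumes X: "findim_subspace_Linf M X" and v: "v \<in> X" and w: "w \<in> X"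
  shows "(\<lambda>x. v x - w x) \<in> X"
proof -
  obtain G where G: "X = {w \<in> Linf_space M. \<exists>c. AE x in M. w x = (\<Sum>g\<in>G. c g *\<^sub>R g x)}"
    using X by (auto simp: findim_subspace_Linf_def)
  obtain c c' where c: "AE x in M. v x = (\<Sum>g\<in>G. c g *\<^sub>R g x)"
    and c': "AE x in M. w x = (\<Sum>g\<in>G. c' g *\<^sub>R g x)"
    using v w G by auto
  have vw: "v \<in> Linf_space M" "w \<in> Linf_space M" using v w G by auto
  then obtain r r' where r: "AE x in M. norm (v x) \<le> r" "AE x in M. norm (w x) \<le> r'"
    by (auto simp: Linf_space_def)
  have "AE x in M. norm (v x - w x) \<le> r + r'"
    using r by eventually_elim (meson add_mono norm_triangle_ineq4 order_trans)
  then have "(\<lambda>x. v x - w x) \<in> Linf_space M" using vw by (auto simp: Linf_space_def)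
  moreover have "AE x in M. v x - w x = (\<Sum>g\<in>G. (c g - c' g) *\<^sub>R g x)"
    using c c' by eventually_elim (simp add: scaleR_diff_left sum_subtractf)
  then have "\<exists>c. AE x in M. v x - w x = (\<Sum>g\<in>G. c g *\<^sub>R g x)"
    by (rule exI[of _ "\<lambda>g. c g - c' g"])
  ultimately show ?thesis unfolding G by simp
qed


section \<open>Quadratic energies\<close>

text \<open>The Taylor expansion is exact for a quadratic energy; symmetry merges the mixed
  terms.\<close>

lemma energy_expansion:
  assumes a: "bilinear a" "\<And>v w. a v w = a w v"
  shows "energy a F w = energy a F v + (a v (w - v) - F (w - v)) + 1 / 2 * a (w - v) (w - v)"
  using a(2)[of w v]
  by (simp add: energy_def bilinear_lsub[OF a(1)] bilinear_rsub[OF a(1)] blinfun.diff_right field_simps)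

text \<open>A negative slope towards \<open>v\<close> would let a short step along the segment lower
  the energy.\<close>

lemma energy_minimizer_variational_inequality:
  assumes a: "bilinear a" "\<And>v w. a v w = a w v" and pos: "\<And>v. 0 \<le> a v v"
    and K: "convex K" and min: "is_arg_min (energy a F) (\<lambda>v. v \<in> K) u" and v: "v \<in> K"
  shows "0 \<le> a u (v - u) - F (v - u)"
proof (rule ccontr)
  define g where "g = a u (v - u) - F (v - u)"
  define q where "q = a (v - u) (v - u)"
  assume "\<not> 0 \<le> a u (v - u) - F (v - u)"
  then have g: "g < 0" by (simp add: g_def)
  have q: "0 \<le> q" unfolding q_def by (rule pos)
  \<comment> \<open>Ensures \<open>t * q \<le> - g\<close>, so the quadratic term offsets at most
    half of the slope; \<open>q + 1\<close> avoids division by zero and the cap 1 stays on the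
    segment.\<close>
  define t where "t = min 1 (- g / (q + 1))"
  have t: "0 < t" "t \<le> 1" using g q by (auto simp: t_def divide_simps)
  have uK: "u \<in> K" using min by (simp add: is_arg_min_def)
  define w where "w = u + t *\<^sub>R (v - u)"
  have "w = (1 - t) *\<^sub>R u + t *\<^sub>R v" by (simp add: w_def algebra_simps)
  then have "w \<in> K" using convexD[OF K uK v, of "1 - t" t] t by simp
  then have "energy a F u \<le> energy a F w"
    using min by (auto simp: is_arg_min_linorder)
  also have "\<dots> = energy a F u + t * g + 1 / 2 * (t * (t * q))"
  proof -
    have "w - u = t *\<^sub>R (v - u)" by (simp add: w_def)
    then show ?thesis
      using energy_expansion[OF a, of F w u]
      by (simp add: g_def q_def bilinear_lmul[OF a(1)] bilinear_rmul[OF a(1)]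
          blinfun.scaleR_right right_diff_distrib)
  qed
  finally have "0 \<le> t * (g + 1 / 2 * (t * q))" by (simp add: algebra_simps)
  then have "0 \<le> g + 1 / 2 * (t * q)" using t by (simp add: zero_le_mult_iff)
  moreover have "t * q \<le> - g"
  proof -
    have "t * q \<le> - g / (q + 1) * q" using q by (intro mult_right_mono) (auto simp: t_def)
    also have "\<dots> \<le> - g" using q g by (simp add: field_simps)
    finally show ?thesis .
  qed
  ultimately show False using g by linarith
qed

text \<open>As \<open>e\<close> decreases, each \<open>e k\<close> in the sum may be replaced by the
  last value \<open>e l\<close>, and the right-hand sides telescope.\<close>

lemma telescoped_descent:
  fixes \<alpha> e D :: "nat \<Rightarrow> real"
  assumes \<alpha>: "\<And>k. k \<ge> 1 \<Longrightarrow> 0 < \<alpha> k"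
    and step: "\<And>k. k \<ge> 1 \<Longrightarrow> \<alpha> k * (e k - p) \<le> D (k - 1) - D k"
    and mono: "\<And>k. k \<ge> 1 \<Longrightarrow> e (Suc k) \<le> e k"
    and l: "l \<ge> 1"
  shows "(\<Sum>k=1..l. \<alpha> k) * (e l - p) \<le> D 0 - D l"
  using l
proof (induction l rule: dec_induct)
  case base
  then show ?case using step[of 1] by simp
next
  case (step n)
  have "(\<Sum>k=1..n. \<alpha> k) * (e (Suc n) - p) \<le> (\<Sum>k=1..n. \<alpha> k) * (e n - p)"
    using mono[of n] step \<alpha> by (intro mult_left_mono sum_nonneg) (auto intro: less_imp_le)
  then show ?case using step assms(2)[of "Suc n"] by (simp add: distrib_right)
qed


section \<open>The error estimate\<close>

theorem theorem3p3:
  fixes \<Omega> \<Omega>\<^sub>d :: "(real^'n) set"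
    and d :: real
    and B :: "'v::{real_inner, complete_space} \<Rightarrow> 'q::{real_inner, complete_space}"
    and \<iota> :: "'q \<Rightarrow> real^'n \<Rightarrow> real^'m"
    and C :: "real^'n \<Rightarrow> (real^'m) set"
    and a :: "'v \<Rightarrow> 'v \<Rightarrow> real"
    and F :: "'v \<Rightarrow>\<^sub>L real"
    and \<nu> M \<beta>\<^sub>0 c\<^sub>P :: real
    and R :: "real^'n \<Rightarrow> real^'m \<Rightarrow> ereal"
    and V\<^sub>h :: "'h \<Rightarrow> 'v set"
    and W\<^sub>h :: "'h \<Rightarrow> (real^'n \<Rightarrow> real^'m) set"
    and \<P>\<^sub>h :: "'h \<Rightarrow> 'v \<Rightarrow> 'v"
    and \<alpha> :: "nat \<Rightarrow> real"
    and u :: "'h \<Rightarrow> nat \<Rightarrow> 'v"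
    and \<psi> :: "'h \<Rightarrow> nat \<Rightarrow> real^'n \<Rightarrow> real^'m"
    and ustar :: 'v
  defines "\<mu> \<equiv> restrict_space (hausdorff_measure d) \<Omega>\<^sub>d"
  defines "\<O> \<equiv> {w \<in> L2_space \<mu>. AE x in \<mu>. w x \<in> C x}"
  defines "K \<equiv> {v. \<iota> (B v) \<in> \<O>}"
  defines "E \<equiv> energy a F"
  defines "E' \<equiv> (\<lambda>v. frechet_derivative E (at v))"
  defines "W \<equiv> Linf_space \<mu>"
  defines "b \<equiv> (\<lambda>v w. L2_inner \<mu> (\<iota> (B v)) w)"
  defines "gradRs \<equiv> grad_superpos (\<lambda>x. conjugate (R x))"
  assumes n: "CARD('n) \<in> {1, 2, 3}"
    and \<Omega>: "polyhedral_domain \<Omega>"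
    and \<Omega>\<^sub>d: "\<Omega>\<^sub>d \<subseteq> closure \<Omega>" "\<Omega>\<^sub>d \<in> sets (hausdorff_measure d)"
    and d: "hausdorff_dim \<Omega>\<^sub>d = d" "d \<le> real CARD('n)"
    and fin: "emeasure (hausdorff_measure d) \<Omega>\<^sub>d < \<infinity>"
    and B: "bounded_linear B" "surj B"
    and \<iota>: "dense_L2_embedding \<mu> \<iota>"
    and C: "AE x in \<mu>. closed (C x) \<and> convex (C x) \<and> interior (C x) \<noteq> {}"
    and K: "closed K" "convex K" "K \<noteq> {}"
    and pos: "0 < \<nu>" "0 < M"
    and a: "bilinear a" "\<And>v w. a v w = a w v"
      "\<And>v. \<nu> * (norm v)\<^sup>2 \<le> a v v" "\<And>v w. a v w \<le> M * norm v * norm w"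
    and R: "caratheodory \<mu> R" "AE x in \<mu>. legendre (R x)" "AE x in \<mu>. eff_dom (R x) = C x"
      "AE x in \<mu>. ((\<lambda>y. R x y / ereal (norm y)) \<longlongrightarrow> \<infinity>) at_infinity"
    and R_cont: "continuous_L2_L1 \<mu> \<O> (superpos R)"
    and gradRs: "\<And>w. w \<in> W \<Longrightarrow> gradRs w \<in> \<O>"
    and V\<^sub>h: "\<And>h. findim_subspace (V\<^sub>h h)"
    and W\<^sub>h: "\<And>h. findim_subspace_Linf \<mu> (W\<^sub>h h)"
    and \<beta>\<^sub>0: "0 < \<beta>\<^sub>0"
    and inf_sup: "\<And>h. ereal \<beta>\<^sub>0 <
      (INF w \<in> {w \<in> W\<^sub>h h. \<not> (AE x in \<mu>. w x = 0)}.
         SUP v \<in> V\<^sub>h h - {0}. ereal (b v w / (norm v * dual_norm \<mu> \<iota> w)))"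
    and \<P>\<^sub>h: "\<And>h. fortin_operator b (V\<^sub>h h) (W\<^sub>h h) c\<^sub>P (\<P>\<^sub>h h)"
    and \<alpha>: "\<And>k. k \<ge> 1 \<Longrightarrow> 0 < \<alpha> k"
      "filterlim (\<lambda>l. \<Sum>k=1..l. \<alpha> k) at_top sequentially"
    and \<psi>0: "\<And>h. \<psi> h 0 \<in> W\<^sub>h h"
    and iterates: "\<And>h k. k \<ge> 1 \<Longrightarrow> u h k \<in> V\<^sub>h h \<and> \<psi> h k \<in> W\<^sub>h h"
      "\<And>h k v. k \<ge> 1 \<Longrightarrow> v \<in> V\<^sub>h h \<Longrightarrow>
         \<alpha> k * a (u h k) v + b v (\<lambda>x. \<psi> h k x - \<psi> h (k - 1) x) = \<alpha> k * F v"
      "\<And>h k w. k \<ge> 1 \<Longrightarrow> w \<in> W\<^sub>h h \<Longrightarrow> b (u h k) w - L2_inner \<mu> (gradRs (\<psi> h k)) w = 0"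
    and minimizer: "is_arg_min E (\<lambda>v. v \<in> K) ustar"
  shows "\<forall>h. \<forall>l\<ge>1.
    \<nu> / 2 * (norm (ustar - u h l))\<^sup>2 \<le>
      L2_inner \<mu> (bregman R (\<iota> (B ustar)) (gradRs (\<psi> h 0))) (\<lambda>x. 1) / (\<Sum>k=1..l. \<alpha> k)
      + M\<^sup>2 / (2 * \<nu>) * (norm (\<P>\<^sub>h h ustar - ustar))\<^sup>2
      + \<bar>E' ustar (\<P>\<^sub>h h ustar - ustar)\<bar>
      + (INF v \<in> K. \<bar>E' ustar (v - u h l)\<bar>)"
proof (intro allI impI)
  fix h :: 'h and l :: nat
  assume l: "1 \<le> l"

  \<comment> \<open>Measure space and pointwise duality of the latent iterates\<close>
  have complete: "complete_measure \<mu>"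
    unfolding \<mu>_def by (rule complete_measure_restrict_space[OF complete_measure_hausdorff \<Omega>\<^sub>d(2)])
  have "emeasure \<mu> (space \<mu>) = emeasure (hausdorff_measure d) \<Omega>\<^sub>d"
    using sets.sets_into_space[OF \<Omega>\<^sub>d(2)] \<Omega>\<^sub>d(2)
    by (simp add: \<mu>_def emeasure_restrict_space space_restrict_space Int_absorb2)
  then interpret finite_measure \<mu>
    using fin by (intro finite_measureI) auto
  have W\<^sub>h_W: "w \<in> W" if "w \<in> W\<^sub>h h" for w
    using W\<^sub>h[of h] that by (auto simp: findim_subspace_Linf_def W_def)
  have \<psi>: "\<psi> h k \<in> W\<^sub>h h" for k
    using \<psi>0 iterates(1)[of k h] by (cases "k = 0") auto
  have \<psi>_W: "\<psi> h k \<in> W" for k using \<psi> W\<^sub>h_W by blast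
  define o\<^sub>h where "o\<^sub>h k = gradRs (\<psi> h k)" for k
  have o\<^sub>h: "o\<^sub>h k \<in> \<O>" for k unfolding o\<^sub>h_def by (rule gradRs[OF \<psi>_W])
  define ostar where "ostar = \<iota> (B ustar)"
  have ustar: "ustar \<in> K" using minimizer by (simp add: is_arg_min_def)
  then have ostar: "ostar \<in> \<O>" by (simp add: K_def ostar_def)

  \<comment> \<open>The inequality is needed on all of \<open>C x\<close>, since
    \<open>ostar\<close> may touch the boundary of the constraint set.\<close>
  have dual: "AE x in \<mu>. gradient (\<lambda>y. real_of_ereal (R x y)) (o\<^sub>h k x) = \<psi> h k x \<and>
      (\<forall>y\<in>C x. real_of_ereal (R x (o\<^sub>h k x)) + \<psi> h k x \<bullet> (y - o\<^sub>h k x) \<le> real_of_ereal (R x y))" for k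
    using R(1)[unfolded caratheodory_def, THEN conjunct2] R(2-4) C
  proof eventually_elim
    case (elim x)
    then have dom: "closed (eff_dom (R x))" "convex (eff_dom (R x))" by auto
    show ?case
      using gradient_conjugate(2,3)[where z = "\<psi> h k x", OF elim(2,1) dom elim(4)] elim(3)
      by (simp add: o\<^sub>h_def gradRs_def grad_superpos_def)
  qed

  \<comment> \<open>Integrated Bregman divergences\<close>
  \<comment> \<open>The divergence from \<open>o\<^sub>h k\<close> with the gradient of
    \<open>R\<close> replaced by \<open>\<psi> h k\<close>; in this form integrability follows from
    the pairing of square-integrable and bounded fields.\<close>
  define T where "T v k = (\<integral>x. superpos R v x - superpos R (o\<^sub>h k) x - \<psi> h k x \<bullet> (v x - o\<^sub>h k x) \<partial>\<mu>)" for v k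
  have int_R: "integrable \<mu> (superpos R v)" if "v \<in> \<O>" for v
    using R_cont that by (auto simp: continuous_L2_L1_def)
  have int_inner: "integrable \<mu> (\<lambda>x. v x \<bullet> w x)" "integrable \<mu> (\<lambda>x. w x \<bullet> v x)" if "v \<in> \<O>" "w \<in> W" for v w
    using integrable_inner_L2_Linf[of v w] that by (auto simp: \<O>_def W_def inner_commute)
  have int_T: "integrable \<mu> (\<lambda>x. superpos R v x - superpos R (o\<^sub>h k) x - \<psi> h k x \<bullet> (v x - o\<^sub>h k x))"
    if "v \<in> \<O>" for v k
    unfolding inner_diff_right
    by (intro Bochner_Integration.integrable_diff int_R int_inner that o\<^sub>h \<psi>_W)
  have T_nonneg: "0 \<le> T v k" if v: "v \<in> \<O>" for v k
    unfolding T_def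
  proof (rule integral_nonneg_AE)
    have "AE x in \<mu>. v x \<in> C x" using v by (simp add: \<O>_def)
    with dual[of k] show "AE x in \<mu>. 0 \<le> superpos R v x - superpos R (o\<^sub>h k) x - \<psi> h k x \<bullet> (v x - o\<^sub>h k x)"
      by eventually_elim (simp add: superpos_def algebra_simps)
  qed
  have T_bregman: "T ostar 0 = L2_inner \<mu> (bregman R ostar (gradRs (\<psi> h 0))) (\<lambda>x. 1)"
  proof -
    have eq: "AE x in \<mu>. superpos R ostar x - superpos R (o\<^sub>h 0) x - \<psi> h 0 x \<bullet> (ostar x - o\<^sub>h 0 x)
        = bregman R ostar (gradRs (\<psi> h 0)) x"
      using dual[of 0] by eventually_elim (simp add: bregman_def grad_superpos_def o\<^sub>h_def)
    have meas: "(\<lambda>x. superpos R ostar x - superpos R (o\<^sub>h 0) x - \<psi> h 0 x \<bullet> (ostar x - o\<^sub>h 0 x))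
        \<in> borel_measurable \<mu>"
      using int_T[OF ostar] by (rule borel_measurable_integrable)
    show ?thesis
      unfolding T_def L2_inner_def
      using integral_cong_AE[OF meas complete_measure.borel_measurable_AE_eq[OF complete meas eq] eq]
      by simp
  qed
  \<comment> \<open>All values of \<open>R\<close> cancel, as do the terms pairing
    \<open>\<psi> h j\<close> with \<open>o\<^sub>h j\<close>.\<close>
  have three_points: "L2_inner \<mu> v (\<lambda>x. \<psi> h k x - \<psi> h j x) - L2_inner \<mu> (o\<^sub>h k) (\<lambda>x. \<psi> h k x - \<psi> h j x)
      = T v j - T v k - T (o\<^sub>h k) j" if v: "v \<in> \<O>" for v j k
  proof -
    have "T v j - T v k - T (o\<^sub>h k) j = (\<integral>x. (v x \<bullet> \<psi> h k x - v x \<bullet> \<psi> h j x)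
        - (o\<^sub>h k x \<bullet> \<psi> h k x - o\<^sub>h k x \<bullet> \<psi> h j x) \<partial>\<mu>)"
      unfolding T_def
      by (subst Bochner_Integration.integral_diff[symmetric]
          | intro Bochner_Integration.integrable_diff int_T v o\<^sub>h)+
         (simp add: inner_diff_right inner_commute algebra_simps)
    also have "\<dots> = (\<integral>x. v x \<bullet> \<psi> h k x - v x \<bullet> \<psi> h j x \<partial>\<mu>)
        - (\<integral>x. o\<^sub>h k x \<bullet> \<psi> h k x - o\<^sub>h k x \<bullet> \<psi> h j x \<partial>\<mu>)"
      by (intro Bochner_Integration.integral_diff Bochner_Integration.integrable_diff int_inner v o\<^sub>h \<psi>_W)
    finally show ?thesis by (simp add: L2_inner_def inner_diff_right)
  qed

  \<comment> \<open>The embedding is additive and homogeneous only almost everywhere, so the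
    difference is taken under the integral.\<close>
  have b_diff: "b (v - v') w = b v w - b v' w" if w: "w \<in> W" for v v' w
  proof -
    have L2: "\<iota> q \<in> L2_space \<mu>" for q using \<iota> by (simp add: dense_L2_embedding_def)
    have int: "integrable \<mu> (\<lambda>x. \<iota> q x \<bullet> w x)" for q
      using integrable_inner_L2_Linf[OF L2] w by (simp add: W_def)
    have "B (v - v') = B v + (- 1) *\<^sub>R B v'"
      using linear_diff[OF bounded_linear.linear[OF B(1)]] by simp
    then have "AE x in \<mu>. \<iota> (B (v - v')) x = \<iota> (B v) x + \<iota> ((- 1) *\<^sub>R B v') x"
      using \<iota>[unfolded dense_L2_embedding_def, THEN conjunct2, THEN conjunct1, rule_format] by metis
    moreover have "AE x in \<mu>. \<iota> ((- 1) *\<^sub>R B v') x = (- 1) *\<^sub>R \<iota> (B v') x"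
      using \<iota>[unfolded dense_L2_embedding_def, THEN conjunct2, THEN conjunct2, THEN conjunct1, rule_format] .
    ultimately have "AE x in \<mu>. \<iota> (B (v - v')) x \<bullet> w x = \<iota> (B v) x \<bullet> w x - \<iota> (B v') x \<bullet> w x"
      by eventually_elim (simp add: inner_diff_left)
    then have "(\<integral>x. \<iota> (B (v - v')) x \<bullet> w x \<partial>\<mu>) = (\<integral>x. \<iota> (B v) x \<bullet> w x - \<iota> (B v') x \<bullet> w x \<partial>\<mu>)"
      by (intro integral_cong_AE borel_measurable_integrable int Bochner_Integration.integrable_diff)
    then show ?thesis by (simp add: b_def L2_inner_def int)
  qed

  \<comment> \<open>Energy descent of the discrete iterates\<close>
  have a_nonneg: "0 \<le> a v v" for v
    using a(3)[of v] pos(1) by (smt (verit) mult_nonneg_nonneg zero_le_power2)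
  note expand = energy_expansion[OF a(1,2), of F, folded E_def]
  define p where "p = \<P>\<^sub>h h ustar"
  have p: "p \<in> V\<^sub>h h" and p_b: "w \<in> W\<^sub>h h \<Longrightarrow> b (ustar - p) w = 0" for w
    using \<P>\<^sub>h[of h] by (auto simp: fortin_operator_def p_def)
  have V_diff: "v - v' \<in> V\<^sub>h h" if "v \<in> V\<^sub>h h" "v' \<in> V\<^sub>h h" for v v'
    using V\<^sub>h[of h] that unfolding findim_subspace_def by (metis span_diff)

  \<comment> \<open>Stated for a pair \<open>y\<close>, \<open>v\<close> with equal pairings against
    \<open>W\<^sub>h h\<close>, to serve twice: with \<open>p\<close>, \<open>ostar\<close> for the
    telescoping bound, and with the previous iterate and its \<open>o\<^sub>h\<close> for
    monotonicity.\<close>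
  have step: "\<alpha> k * (E (u h k) - E y) \<le> T v (k - 1) - T v k"
    if k: "k \<ge> 1" and y: "y \<in> V\<^sub>h h" and v: "v \<in> \<O>"
      and yv: "\<And>w. w \<in> W\<^sub>h h \<Longrightarrow> b y w = L2_inner \<mu> v w" for k y v
  proof -
    define \<delta> where "\<delta> = (\<lambda>x. \<psi> h k x - \<psi> h (k - 1) x)"
    have \<delta>: "\<delta> \<in> W\<^sub>h h" unfolding \<delta>_def by (rule findim_subspace_Linf_diff[OF W\<^sub>h \<psi> \<psi>])
    have u: "u h k \<in> V\<^sub>h h" using iterates(1) k by blast
    \<comment> \<open>Expansion at \<open>u h k\<close>, dropping the nonnegative quadratic
      term.\<close>
    have "E (u h k) - E y \<le> a (u h k) (u h k - y) - F (u h k - y)"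
      using expand[of y "u h k"] a_nonneg[of "y - u h k"]
      by (simp add: bilinear_rsub[OF a(1)] blinfun.diff_right)
    then have "\<alpha> k * (E (u h k) - E y) \<le> \<alpha> k * (a (u h k) (u h k - y) - F (u h k - y))"
      using \<alpha>(1)[OF k] by (intro mult_left_mono) auto
    also have "\<dots> = - b (u h k - y) \<delta>"
      using iterates(2)[OF k V_diff[OF u y]] by (simp add: \<delta>_def algebra_simps)
    also have "\<dots> = L2_inner \<mu> v \<delta> - L2_inner \<mu> (o\<^sub>h k) \<delta>"
      using b_diff[OF W\<^sub>h_W[OF \<delta>]] iterates(3)[OF k \<delta>] yv[OF \<delta>] by (simp add: o\<^sub>h_def)
    also have "\<dots> = T v (k - 1) - T v k - T (o\<^sub>h k) (k - 1)"
      unfolding \<delta>_def by (rule three_points[OF v])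
    finally show ?thesis using T_nonneg[OF o\<^sub>h, of k "k - 1"] by simp
  qed

  have "(\<Sum>k=1..l. \<alpha> k) * (E (u h l) - E p) \<le> T ostar 0 - T ostar l"
  proof (rule telescoped_descent[OF \<alpha>(1) _ _ l])
    fix k :: nat assume k: "1 \<le> k"
    \<comment> \<open>The Fortin property lets \<open>p\<close> replace \<open>ustar\<close> in
      pairings with the discrete latent space.\<close>
    have "b p w = L2_inner \<mu> ostar w" if "w \<in> W\<^sub>h h" for w
      using p_b[OF that] b_diff[OF W\<^sub>h_W[OF that]] by (simp add: b_def ostar_def)
    then show "\<alpha> k * (E (u h k) - E p) \<le> T ostar (k - 1) - T ostar k"
      by (rule step[OF k p ostar])
    \<comment> \<open>The comparison pair is the iterate at \<open>k\<close>, whose second equation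
      requires \<open>k \<ge> 1\<close>; the divergence of \<open>o\<^sub>h k\<close> from itself
      vanishes.\<close>
    have "\<alpha> (Suc k) * (E (u h (Suc k)) - E (u h k)) \<le> T (o\<^sub>h k) (Suc k - 1) - T (o\<^sub>h k) (Suc k)"
      using iterates(1)[OF k] iterates(3)[OF k] by (intro step o\<^sub>h) (auto simp: o\<^sub>h_def)
    also have "T (o\<^sub>h k) (Suc k - 1) = 0" by (simp add: T_def)
    finally have "\<alpha> (Suc k) * (E (u h (Suc k)) - E (u h k)) \<le> 0"
      using T_nonneg[OF o\<^sub>h, of k "Suc k"] by simp
    then show "E (u h (Suc k)) \<le> E (u h k)"
      using \<alpha>(1)[of "Suc k"] by (simp add: mult_le_0_iff)
  qed
  also have "\<dots> \<le> T ostar 0" using T_nonneg[OF ostar] by simp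
  finally have "(\<Sum>k=1..l. \<alpha> k) * (E (u h l) - E p) \<le> T ostar 0" .
  moreover have "0 < (\<Sum>k=1..l. \<alpha> k)" using l \<alpha>(1) by (intro sum_pos) auto
  ultimately have energy: "E (u h l) \<le> E p + T ostar 0 / (\<Sum>k=1..l. \<alpha> k)"
    by (simp add: field_simps)

  \<comment> \<open>From energy decay to the error bound\<close>
  have E': "E' v w = a v w - F w" for v w
    unfolding E'_def E_def by (rule frechet_derivative_energy[OF a(1,2,4)])
  \<comment> \<open>Continuity gives the factor \<open>M / 2\<close>; the stated one is no smaller
    because \<open>\<nu> \<le> M\<close>, which follows by testing both bounds on \<open>a\<close>
    with the nonzero vector \<open>p - ustar\<close>.\<close>
  have quad: "1 / 2 * a (p - ustar) (p - ustar) \<le> M\<^sup>2 / (2 * \<nu>) * (norm (p - ustar))\<^sup>2"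
  proof (cases "p = ustar")
    case True
    then show ?thesis by (simp add: bilinear_lzero[OF a(1)])
  next
    case False
    have aM: "a (p - ustar) (p - ustar) \<le> M * (norm (p - ustar))\<^sup>2"
      using a(4)[of "p - ustar" "p - ustar"] by (simp add: power2_eq_square)
    then have "\<nu> * (norm (p - ustar))\<^sup>2 \<le> M * (norm (p - ustar))\<^sup>2"
      using a(3)[of "p - ustar"] by linarith
    then have "\<nu> \<le> M" using False by simp
    then have "M \<le> M\<^sup>2 / \<nu>" using pos by (simp add: field_simps power2_eq_square)
    then have "M * (norm (p - ustar))\<^sup>2 \<le> M\<^sup>2 / \<nu> * (norm (p - ustar))\<^sup>2"
      by (rule mult_right_mono) simp
    with aM show ?thesis by (simp add: field_simps)
  qed
  let ?rhs = "T ostar 0 / (\<Sum>k=1..l. \<alpha> k) + M\<^sup>2 / (2 * \<nu>) * (norm (p - ustar))\<^sup>2 + \<bar>E' ustar (p - ustar)\<bar>"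
  \<comment> \<open>Everything except the infimum is moved to the left, so the bound can be proved
    for each \<open>v\<close> in the nonempty set \<open>K\<close>. The variational inequality at
    \<open>v\<close> bounds \<open>- E' ustar (u h l - ustar)\<close> by
    \<open>E' ustar (v - u h l)\<close>.\<close>
  have "\<nu> / 2 * (norm (ustar - u h l))\<^sup>2 - ?rhs \<le> \<bar>E' ustar (v - u h l)\<bar>" if v: "v \<in> K" for v
  proof -
    have "\<nu> / 2 * (norm (ustar - u h l))\<^sup>2 \<le> 1 / 2 * a (u h l - ustar) (u h l - ustar)"
      using a(3)[of "u h l - ustar"] by (simp add: norm_minus_commute)
    moreover have "0 \<le> E' ustar (v - ustar)"
      using energy_minimizer_variational_inequality[OF a(1,2) a_nonneg K(2) minimizer[unfolded E_def] v]
      by (simp add: E')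
    moreover have "E' ustar (v - u h l) = E' ustar (v - ustar) - E' ustar (u h l - ustar)"
      by (simp add: E' bilinear_rsub[OF a(1)] blinfun.diff_right)
    ultimately show ?thesis
      using expand[of "u h l" ustar] expand[of p ustar] energy quad
        abs_ge_self[of "E' ustar (p - ustar)"] abs_ge_self[of "E' ustar (v - u h l)"]
      unfolding E'[symmetric] by linarith
  qed
  then have "\<nu> / 2 * (norm (ustar - u h l))\<^sup>2 - ?rhs \<le> (INF v \<in> K. \<bar>E' ustar (v - u h l)\<bar>)"
    by (rule cINF_greatest[OF K(3)])
  then show "\<nu> / 2 * (norm (ustar - u h l))\<^sup>2 \<le>
      L2_inner \<mu> (bregman R (\<iota> (B ustar)) (gradRs (\<psi> h 0))) (\<lambda>x. 1) / (\<Sum>k=1..l. \<alpha> k)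
      + M\<^sup>2 / (2 * \<nu>) * (norm (\<P>\<^sub>h h ustar - ustar))\<^sup>2
      + \<bar>E' ustar (\<P>\<^sub>h h ustar - ustar)\<bar>
      + (INF v \<in> K. \<bar>E' ustar (v - u h l)\<bar>)"
    using T_bregman by (simp add: p_def ostar_def)
qed

end
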